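(* Let $\mathbf{u}$ be a uniformly recurrent infinite word over a finite alphabet $\mathcal{A}$ with $\#\mathcal{A}=k$, and assume that every palindrome in $\mathcal{L}(\mathbf{u})$ has a unique palindromic extension in $\mathbf{u}$. Then $\mathbf{u}$ is rich if and only if every factor of $\mathbf{u}$ has exactly $k$ return words.
   Context: An infinite word over a finite alphabet $\mathcal{A}$ is a one-sided infinite sequence $\mathbf{u}=u_0u_1u_2\ldots$ of letters of $\mathcal{A}$ in which every letter of $\mathcal{A}$ occurs. Its language $\mathcal{L}(\mathbf{u})$ is the set of all its finite factors (contiguous subwords), including the empty word. An occurrence of a factor $w$ is an index $i$ such that $w$ is a prefix of $u_iu_{i+1}u_{i+2}\ldots$. $\mathbf{u}$ is recurrent if every factor has at least two (equivalently infinitely many) occurrences, and uniformly recurrent if, moreover, for every factor $w$ the distances between successive occurrences of $w$ are bounded. If $i<j$ are two successive occurrences of $w$ in $\mathbf{u}$, the word $u_iu_{i+1}\cdots u_{j-1}$ is a return word of $w$; the return words of $w$ are counted as distinct words. A word is a palindrome if it equals its reversal (the empty word is a palindrome). For a palindrome $w\in\mathcal{L}(\mathbf{u})$, a palindromic extension of $w$ is a word $awa\in\mathcal{L}(\mathbf{u})$ with $a\in\mathcal{A}$. $\mathbf{u}$ is rich if every factor $w$ of $\mathbf{u}$ contains exactly $|w|+1$ distinct palindromic factors (including the empty word). *)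

theory Defs
  imports Main "HOL-Library.Sublist" "HOL-Library.Omega_Words_Fun"
begin

definition infinite_word_over :: "'a set \<Rightarrow> 'a word \<Rightarrow> bool" where
  "infinite_word_over A u \<longleftrightarrow> finite A \<and> range u = A"

definition occurrence :: "'a word \<Rightarrow> 'a list \<Rightarrow> nat \<Rightarrow> bool" where
  "occurrence u w i \<longleftrightarrow> subsequence u i (i + length w) = w"

definition language :: "'a word \<Rightarrow> 'a list set" where
  "language u = {w. \<exists>i. occurrence u w i}"

definition successive_occurrences :: "'a word \<Rightarrow> 'a list \<Rightarrow> nat \<Rightarrow> nat \<Rightarrow> bool" where
  "successive_occurrences u w i j \<longleftrightarrow>
     i < j \<and> occurrence u w i \<and> occurrence u w j \<and> (\<forall>m. i < m \<and> m < j \<longrightarrow> \<not> occurrence u w m)"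

definition recurrent :: "'a word \<Rightarrow> bool" where
  "recurrent u \<longleftrightarrow> (\<forall>w\<in>language u. \<exists>i j. i < j \<and> occurrence u w i \<and> occurrence u w j)"

definition uniformly_recurrent :: "'a word \<Rightarrow> bool" where
  "uniformly_recurrent u \<longleftrightarrow> recurrent u \<and>
     (\<forall>w\<in>language u. \<exists>N. \<forall>i j. successive_occurrences u w i j \<longrightarrow> j - i \<le> N)"

definition return_words :: "'a word \<Rightarrow> 'a list \<Rightarrow> 'a list set" where
  "return_words u w = {subsequence u i j | i j. successive_occurrences u w i j}"

definition palindrome :: "'a list \<Rightarrow> bool" where
  "palindrome w \<longleftrightarrow> rev w = w"

definition palindromic_extensions :: "'a word \<Rightarrow> 'a list \<Rightarrow> 'a list set" where
  "palindromic_extensions u w = {a # w @ [a] | a. a # w @ [a] \<in> language u}"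

definition rich :: "'a word \<Rightarrow> bool" where
  "rich u \<longleftrightarrow> (\<forall>w\<in>language u. card {p. palindrome p \<and> sublist p w} = length w + 1)"

end

theory Submission
  imports Defs
begin

text \<open>
  The first ingredient is the usual criterion: \<open>u\<close> is rich iff the longest palindromic suffix of
  every nonempty factor occurs only once in that factor. It follows that, in a rich word, every factor that
  starts and ends with \<open>w\<close> or its reversal, with no such occurrence in between (a brick of \<open>w\<close>),
  is a palindrome, and that \<open>u\<close> is rich as soon as all complete returns of palindromes are palindromes.

  Unique palindromic extensions arrange the palindromes of \<open>u\<close> into \<open>k + 1\<close> towers, one for the empty
  core and one for each letter. By uniform recurrence every tower contains \<open>w\<close>, and the first palindrome of
  the tower containing \<open>w\<close> is a palindromic brick of \<open>w\<close>, except when \<open>w\<close> itself lies in the tower;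
  every palindromic brick arises once in this way. So there are \<open>k\<close> palindromic bricks if \<open>w\<close> is a
  palindrome, and \<open>k + 1\<close> otherwise. For a palindrome the bricks are its complete returns, which settles
  everything except the return words of a nonpalindromic \<open>w\<close> in a rich word.

  In that case \<open>u\<close> is a walk on the bricks of \<open>w\<close>, and the return words of \<open>w\<close> correspond to
  the undirected edges of the walk. A first return of the walk to a brick spells a complete return of a
  palindrome, so the walk comes back through the edge by which it left. Hence a step uses a new edge exactly
  when it reaches a new brick, the edges form a tree, and there are \<open>k\<close> of them.
\<close>

subsection \<open>Occurrences and palindromes\<close>

lemma occurrence_iff: "occurrence u w i \<longleftrightarrow> (\<forall>t<length w. u (i + t) = w ! t)"
  unfolding occurrence_def by (subst list_eq_iff_nth_eq) simp

lemma occurrence_Nil [simp]: "occurrence u [] i"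
  by (simp add: occurrence_iff)

lemma occurrence_rev_palindrome: "palindrome w \<Longrightarrow> occurrence u (rev w) i \<longleftrightarrow> occurrence u w i"
  by (simp add: palindrome_def)

lemma occurrence_subsequence: "occurrence u (u [i \<rightarrow> j]) i"
  by (simp add: occurrence_iff)

lemma subsequence_in_language [simp]: "u [i \<rightarrow> j] \<in> language u"
  using occurrence_subsequence unfolding language_def by blast

text \<open>Equal windows carry the same factors at equal offsets; this moves what is known about
  one copy of a brick to any other copy.\<close>

lemma occurrence_subsequence_shift:
  assumes "occurrence u (u [a \<rightarrow> b]) x" and "a + d + length w \<le> b"
  shows "occurrence u w (x + d) \<longleftrightarrow> occurrence u w (a + d)"
proof -
  have "u (x + d + t) = u (a + d + t)" if "t < length w" for t
    using assms(1)[unfolded occurrence_iff, rule_format, of "d + t"] assms(2) that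
    by (simp add: add.assoc)
  then show ?thesis unfolding occurrence_iff by simp
qed

lemma sublist_subsequence_iff:
  assumes "i \<le> j"
  shows "sublist q (u [i \<rightarrow> j]) \<longleftrightarrow> (\<exists>x\<ge>i. x + length q \<le> j \<and> occurrence u q x)"
proof
  assume "sublist q (u [i \<rightarrow> j])"
  then obtain ps ss where eq: "u [i \<rightarrow> j] = ps @ q @ ss"
    unfolding sublist_def by blast
  then have len: "j - i = length ps + length q + length ss"
    by (metis add.assoc length_append subsequence_length)
  have "u (i + length ps + t) = q ! t" if "t < length q" for t
  proof -
    have "u (i + (length ps + t)) = (u [i \<rightarrow> j]) ! (length ps + t)"
      using len that by simp
    then show ?thesis using that unfolding eq by (simp add: nth_append add.assoc)
  qed
  then have "occurrence u q (i + length ps)" by (simp add: occurrence_iff)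
  then show "\<exists>x\<ge>i. x + length q \<le> j \<and> occurrence u q x"
    using len assms by (intro exI[of _ "i + length ps"]) auto
next
  assume "\<exists>x\<ge>i. x + length q \<le> j \<and> occurrence u q x"
  then obtain x where x: "i \<le> x" "x + length q \<le> j" "u [x \<rightarrow> x + length q] = q"
    unfolding occurrence_def by blast
  have "u [x \<rightarrow> x + length q] = take (length q) (drop (x - i) (u [i \<rightarrow> j]))"
    using x by (simp add: min_absorb1)
  then show "sublist q (u [i \<rightarrow> j])"
    using x(3) sublist_order.order.trans[OF sublist_take sublist_drop] by metis
qed

lemma suffix_subsequenceI: "i \<le> m \<Longrightarrow> m \<le> j \<Longrightarrow> Sublist.suffix (u [m \<rightarrow> j]) (u [i \<rightarrow> j])"
  using suffix_drop[of "m - i" "u [i \<rightarrow> j]"] by simp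

lemma suffix_subsequence_iff:
  assumes "i \<le> j"
  shows "Sublist.suffix q (u [i \<rightarrow> j]) \<longleftrightarrow> (\<exists>m. i \<le> m \<and> m \<le> j \<and> q = u [m \<rightarrow> j])"
proof
  assume "Sublist.suffix q (u [i \<rightarrow> j])"
  then obtain ps where ps: "u [i \<rightarrow> j] = ps @ q" by (auto simp: Sublist.suffix_def)
  then have "length q \<le> j - i" by (metis le_add2 length_append subsequence_length)
  moreover have "q = drop (length (u [i \<rightarrow> j]) - length q) (u [i \<rightarrow> j])" unfolding ps by simp
  ultimately show "\<exists>m. i \<le> m \<and> m \<le> j \<and> q = u [m \<rightarrow> j]"
    using assms by (intro exI[of _ "j - length q"]) auto
next
  assume "\<exists>m. i \<le> m \<and> m \<le> j \<and> q = u [m \<rightarrow> j]"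
  then obtain m where "i \<le> m" "q = drop (m - i) (u [i \<rightarrow> j])" by auto
  then show "Sublist.suffix q (u [i \<rightarrow> j])" using suffix_drop by blast
qed

text \<open>Mirror positions are described by \<open>x + y + 1 = i + j\<close>, a symmetric form
  free of truncated subtraction on \<open>nat\<close>.\<close>

lemma palindrome_subsequence_iff:
  "palindrome (u [i \<rightarrow> j]) \<longleftrightarrow> (\<forall>x\<ge>i. \<forall>y\<ge>i. x + y + 1 = i + j \<longrightarrow> u x = u y)"
proof
  assume "palindrome (u [i \<rightarrow> j])"
  then have eq: "rev (u [i \<rightarrow> j]) = u [i \<rightarrow> j]" by (simp add: palindrome_def)
  show "\<forall>x\<ge>i. \<forall>y\<ge>i. x + y + 1 = i + j \<longrightarrow> u x = u y"
  proof (intro allI impI)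
    fix x y assume h: "i \<le> x" "i \<le> y" "x + y + 1 = i + j"
    have "u x = (u [i \<rightarrow> j]) ! (x - i)" using h by simp
    also have "\<dots> = rev (u [i \<rightarrow> j]) ! (x - i)" using eq by simp
    also have "\<dots> = (u [i \<rightarrow> j]) ! (j - i - Suc (x - i))" using h by (subst rev_nth) auto
    also have "\<dots> = u (i + (j - i - Suc (x - i)))" using h by (subst subsequence_nth) auto
    also have "i + (j - i - Suc (x - i)) = y" using h by simp
    finally show "u x = u y" .
  qed
next
  assume h: "\<forall>x\<ge>i. \<forall>y\<ge>i. x + y + 1 = i + j \<longrightarrow> u x = u y"
  have "rev (u [i \<rightarrow> j]) ! t = (u [i \<rightarrow> j]) ! t" if "t < j - i" for t
    using that h[rule_format, of "i + (j - i - Suc t)" "i + t"] by (simp add: rev_nth)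
  then show "palindrome (u [i \<rightarrow> j])"
    unfolding palindrome_def by (subst list_eq_iff_nth_eq) simp
qed

lemma occurrence_reflect:
  assumes "palindrome (u [i \<rightarrow> j])" and "occurrence u w x" and "i \<le> x" and "x + length w \<le> j"
  shows "occurrence u (rev w) (i + j - (x + length w))"
proof -
  have "u (i + j - (x + length w) + t) = rev w ! t" if t: "t < length w" for t
  proof -
    have "u (i + j - (x + length w) + t) = u (x + (length w - Suc t))"
      using assms(1)[unfolded palindrome_subsequence_iff, rule_format,
          of "i + j - (x + length w) + t" "x + (length w - Suc t)"] assms(3,4) t by simp
    also have "\<dots> = w ! (length w - Suc t)"
      using assms(2)[unfolded occurrence_iff, rule_format, of "length w - Suc t"] t by simp
    finally show ?thesis using t by (simp add: rev_nth)
  qed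
  then show ?thesis by (simp add: occurrence_iff)
qed

section \<open>Richness and longest palindromic suffixes\<close>

lemma palindrome_Nil [simp]: "palindrome []" and palindrome_singleton [simp]: "palindrome [a]"
  by (simp_all add: palindrome_def)

text \<open>Any other palindromic suffix \<open>p\<close> is a proper suffix of \<open>q\<close>,
  hence by reversal also a prefix of \<open>q\<close>. That copy ends before the last letter
  \<open>a\<close>, so \<open>p\<close> is already a factor of \<open>w\<close>.\<close>

lemma palindromic_factors_snoc:
  assumes "palindrome q" and "Sublist.suffix q (w @ [a])"
    and longest: "\<And>p. palindrome p \<Longrightarrow> Sublist.suffix p (w @ [a]) \<Longrightarrow> length p \<le> length q"
  shows "{p. palindrome p \<and> sublist p (w @ [a])} = insert q {p. palindrome p \<and> sublist p w}"
proof -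
  have "sublist p w" if p: "palindrome p" "Sublist.suffix p (w @ [a])" "p \<noteq> q" for p
  proof -
    have "Sublist.suffix p q"
      using longest[OF p(1,2)] p(2) assms(2) by (metis suffix_length_suffix)
    then have "Sublist.prefix p q"
      using p(1) assms(1) by (metis palindrome_def suffix_to_prefix)
    then obtain r where r: "q = p @ r" "r \<noteq> []" using p(3) by (auto simp: Sublist.prefix_def)
    obtain s where "w @ [a] = s @ p @ r" using assms(2) r by (auto simp: Sublist.suffix_def)
    then have "w = s @ p @ butlast r" using r(2)
      by (metis append_is_Nil_conv butlast_append butlast_snoc)
    then show ?thesis by simp
  qed
  then show ?thesis using assms(1,2) by (auto simp: sublist_snoc intro: suffix_imp_sublist)
qed

lemma ex_longest_palindromic_suffix:
  obtains q where "palindrome q" "Sublist.suffix q w"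
    "\<And>p. palindrome p \<Longrightarrow> Sublist.suffix p w \<Longrightarrow> length p \<le> length q"
proof -
  have "\<exists>q. (palindrome q \<and> Sublist.suffix q w) \<and>
      (\<forall>p. palindrome p \<and> Sublist.suffix p w \<longrightarrow> length p \<le> length q)"
    by (rule ex_has_greatest_nat[where k = "[]" and b = "Suc (length w)"])
      (auto simp: less_Suc_eq_le suffix_length_le)
  then show ?thesis using that by blast
qed

lemma finite_palindromic_factors: "finite {p. palindrome p \<and> sublist p w}"
  by (rule finite_subset[OF _ finite_set[of "sublists w"]]) auto

lemma language_appendD:
  assumes "v @ w \<in> language u"
  shows "v \<in> language u"
proof -
  from assms obtain i where "\<forall>t<length v + length w. u (i + t) = (v @ w) ! t"
    by (auto simp: language_def occurrence_iff)
  then have "occurrence u v i" by (auto simp: occurrence_iff nth_append)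
  then show ?thesis by (auto simp: language_def)
qed

lemma in_languageE:
  assumes "w \<in> language u"
  obtains i where "u [i \<rightarrow> i + length w] = w"
  using assms unfolding language_def occurrence_def by auto

text \<open>Each appended letter adds one palindromic factor or none, according to whether the
  longest palindromic suffix \<open>q\<close> is new. So the count \<open>length w + 1\<close>
  persists exactly when \<open>q\<close> is new at every step.\<close>

lemma rich_iff_unioccurrent:
  "rich u \<longleftrightarrow> (\<forall>w a q. w @ [a] \<in> language u \<longrightarrow> palindrome q \<longrightarrow> Sublist.suffix q (w @ [a]) \<longrightarrow>
     (\<forall>p. palindrome p \<longrightarrow> Sublist.suffix p (w @ [a]) \<longrightarrow> length p \<le> length q) \<longrightarrow> \<not> sublist q w)"
  (is "_ \<longleftrightarrow> ?R")
proof
  assume rich: "rich u"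
  show ?R
  proof (intro allI impI notI)
    fix w a q
    assume wa: "w @ [a] \<in> language u" and q: "palindrome q" "Sublist.suffix q (w @ [a])"
      "\<forall>p. palindrome p \<longrightarrow> Sublist.suffix p (w @ [a]) \<longrightarrow> length p \<le> length q"
      and sub: "sublist q w"
    have "card {p. palindrome p \<and> sublist p (w @ [a])} = length w + 2"
      using rich wa unfolding rich_def by auto
    moreover have "card {p. palindrome p \<and> sublist p w} = length w + 1"
      using rich language_appendD[OF wa] unfolding rich_def by auto
    moreover have "{p. palindrome p \<and> sublist p (w @ [a])} = {p. palindrome p \<and> sublist p w}"
      using palindromic_factors_snoc[OF q(1,2)] q sub by (simp add: insert_absorb)
    ultimately show False by simp
  qed
next
  assume R: ?R
  have "card {p. palindrome p \<and> sublist p w} = length w + 1" if "w \<in> language u" for w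
    using that
  proof (induction w rule: rev_induct)
    case Nil
    have eq: "{p. palindrome p \<and> sublist p []} = {[]}" by auto
    show ?case unfolding eq by simp
  next
    case (snoc a w)
    obtain q where q: "palindrome q" "Sublist.suffix q (w @ [a])"
      "\<And>p. palindrome p \<Longrightarrow> Sublist.suffix p (w @ [a]) \<Longrightarrow> length p \<le> length q"
      using ex_longest_palindromic_suffix by blast
    have "\<not> sublist q w" using R[rule_format, OF snoc.prems q(1,2)] q(3) by simp
    then show ?case
      using palindromic_factors_snoc[OF q] snoc.IH[OF language_appendD[OF snoc.prems]]
      by (simp add: finite_palindromic_factors)
  qed
  then show "rich u" unfolding rich_def by blast
qed

text \<open>The same criterion by positions in \<open>u\<close>: the factor is
  \<open>u [i \<rightarrow> j]\<close>, its longest palindromic suffix starts at \<open>m\<close>,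
  and \<open>x < m\<close> places the earlier copy inside the factor without its last
  letter.\<close>

lemma rich_iff_unioccurrent_position:
  "rich u \<longleftrightarrow> (\<forall>i m j x. i \<le> x \<longrightarrow> x < m \<longrightarrow> m < j \<longrightarrow> palindrome (u [m \<rightarrow> j]) \<longrightarrow>
     (\<forall>n. i \<le> n \<longrightarrow> n < m \<longrightarrow> \<not> palindrome (u [n \<rightarrow> j])) \<longrightarrow> \<not> occurrence u (u [m \<rightarrow> j]) x)"
  (is "_ \<longleftrightarrow> ?R")
proof
  assume rich: "rich u"
  show ?R
  proof (intro allI impI notI)
    fix i m j x
    assume h: "i \<le> x" "x < m" "m < j" "palindrome (u [m \<rightarrow> j])"
      "\<forall>n. i \<le> n \<longrightarrow> n < m \<longrightarrow> \<not> palindrome (u [n \<rightarrow> j])" "occurrence u (u [m \<rightarrow> j]) x"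
    define w where "w = u [i \<rightarrow> j - 1]"
    define a where "a = u (j - 1)"
    have ij: "u [i \<rightarrow> j] = w @ [a]"
      using h unfolding w_def a_def subsequence_def by (cases j) auto
    have sub: "sublist (u [m \<rightarrow> j]) w"
      unfolding w_def using h by (subst sublist_subsequence_iff) (auto intro!: exI[of _ x])
    have suf: "Sublist.suffix (u [m \<rightarrow> j]) (w @ [a])"
      using suffix_subsequenceI[of i m j u] h by (simp only: ij less_imp_le order.strict_trans1[OF h(1,2)])
    have longest: "length p \<le> length (u [m \<rightarrow> j])"
      if p: "palindrome p" "Sublist.suffix p (w @ [a])" for p
    proof -
      obtain n where n: "i \<le> n" "n \<le> j" "p = u [n \<rightarrow> j]"
        using p(2) h unfolding ij[symmetric] by (subst (asm) suffix_subsequence_iff) auto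
      then have "m \<le> n" using h(5) p(1) by (meson not_le)
      then show ?thesis using n by simp
    qed
    have wa: "w @ [a] \<in> language u" unfolding ij[symmetric] by simp
    have "\<not> sublist (u [m \<rightarrow> j]) w"
      using rich[unfolded rich_iff_unioccurrent, rule_format, OF wa h(4) suf] longest by simp
    then show False using sub by contradiction
  qed
next
  assume R: ?R
  show "rich u"
    unfolding rich_iff_unioccurrent
  proof (intro allI impI notI)
    fix w a q
    assume wa: "w @ [a] \<in> language u" and q: "palindrome q" "Sublist.suffix q (w @ [a])"
      "\<forall>p. palindrome p \<longrightarrow> Sublist.suffix p (w @ [a]) \<longrightarrow> length p \<le> length q"
      and sub: "sublist q w"
    obtain i where i: "u [i \<rightarrow> i + length (w @ [a])] = w @ [a]"
      using in_languageE[OF wa] by blast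
    define j where "j = i + length (w @ [a])"
    have ij: "w @ [a] = u [i \<rightarrow> j]" "i < j" using i by (simp_all add: j_def)
    have w: "w = u [i \<rightarrow> j - 1]"
    proof -
      have "w = take (length w) (w @ [a])" by simp
      also have "\<dots> = take (length w) (u [i \<rightarrow> j])" using ij by simp
      also have "\<dots> = u [i \<rightarrow> j - 1]" by (simp add: j_def)
      finally show ?thesis .
    qed
    obtain m where m: "i \<le> m" "m \<le> j" "q = u [m \<rightarrow> j]"
      using q(2) ij by (auto simp: suffix_subsequence_iff)
    \<comment> \<open>The one-letter suffix is a palindrome, so \<open>q\<close> is nonempty and
      \<open>m < j\<close>.\<close>
    have "Sublist.suffix [a] (w @ [a])" by (rule Sublist.suffixI[OF refl])
    then have "length [a] \<le> length q" using q(3)[rule_format, of "[a]"] by simp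
    then have mj: "m < j" using m by simp
    obtain x where x: "i \<le> x" "x + length q \<le> j - 1" "occurrence u q x"
      using sub ij(2) unfolding w by (subst (asm) sublist_subsequence_iff) auto
    have np: "\<not> palindrome (u [n \<rightarrow> j])" if n: "i \<le> n" "n < m" for n
    proof
      assume "palindrome (u [n \<rightarrow> j])"
      moreover have "Sublist.suffix (u [n \<rightarrow> j]) (w @ [a])"
        using suffix_subsequenceI[of i n j u] n mj by (simp only: ij(1) less_imp_le order.strict_trans[OF n(2) mj])
      ultimately have "length (u [n \<rightarrow> j]) \<le> length q" using q(3) by blast
      then show False using m mj n by simp
    qed
    have "x < m" using x(2) m(1,2) mj unfolding m(3) by simp
    with x(1) have "\<not> occurrence u (u [m \<rightarrow> j]) x"
      using mj q(1)[unfolded m(3)] np by (rule R[rule_format])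
    then show False using x(3) unfolding m(3) by contradiction
  qed
qed

section \<open>Consecutive occurrences of a word or its reversal\<close>

definition occurrence_or_rev :: "'a word \<Rightarrow> 'a list \<Rightarrow> nat \<Rightarrow> bool" where
  "occurrence_or_rev u w i \<longleftrightarrow> occurrence u w i \<or> occurrence u (rev w) i"

definition consecutive :: "'a word \<Rightarrow> 'a list \<Rightarrow> nat \<Rightarrow> nat \<Rightarrow> bool" where
  "consecutive u w i j \<longleftrightarrow> i < j \<and> occurrence_or_rev u w i \<and> occurrence_or_rev u w j \<and>
     (\<forall>m. i < m \<and> m < j \<longrightarrow> \<not> occurrence_or_rev u w m)"

lemma consecutive_palindrome:
  "palindrome w \<Longrightarrow> consecutive u w i j \<longleftrightarrow> successive_occurrences u w i j"
  by (simp add: consecutive_def successive_occurrences_def occurrence_or_rev_def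
      occurrence_rev_palindrome)

lemma occurrence_or_rev_reflect:
  assumes "palindrome (u [i \<rightarrow> j + length w])" and "occurrence_or_rev u w x" and "i \<le> x" and "x \<le> j"
  shows "occurrence_or_rev u w (i + j - x)"
proof -
  have "i + (j + length w) - (x + length w) = i + j - x" by simp
  then show ?thesis
    using occurrence_reflect[OF assms(1), of w x] occurrence_reflect[OF assms(1), of "rev w" x] assms
    unfolding occurrence_or_rev_def by auto
qed

text \<open>Let the longest palindromic suffix of the window start at \<open>m\<close>; by richness
  it has no earlier copy there. If \<open>m < j\<close>, reflecting the occurrence at
  \<open>j\<close> gives one at \<open>m\<close>, and the gap forces \<open>m = i\<close>. If
  \<open>m \<ge> j\<close>, the suffix lies within the final copy of \<open>w\<close> or
  \<open>rev w\<close>, and the copy at \<open>i\<close> repeats it too early.\<close>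

lemma rich_consecutive_palindrome:
  assumes rich: "rich u" and cons: "consecutive u w i j"
  shows "palindrome (u [i \<rightarrow> j + length w])"
proof -
  let ?l = "length w"
  have ij: "i < j" "occurrence_or_rev u w i" "occurrence_or_rev u w j"
    and gap: "\<And>m. i < m \<Longrightarrow> m < j \<Longrightarrow> \<not> occurrence_or_rev u w m"
    using cons unfolding consecutive_def by auto
  define m where "m = (LEAST m. i \<le> m \<and> palindrome (u [m \<rightarrow> j + ?l]))"
  \<comment> \<open>The one-letter suffix is a candidate, so the \<open>LEAST\<close> is attained;
    \<open>i < j\<close> makes this valid for empty \<open>w\<close> too.\<close>
  have "u [j + ?l - 1 \<rightarrow> j + ?l] = [u (j + ?l - 1)]"
    using ij(1) by (cases "j + ?l") auto
  then have last: "i \<le> j + ?l - 1 \<and> palindrome (u [j + ?l - 1 \<rightarrow> j + ?l])"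
    using ij(1) by simp
  have m: "i \<le> m" "palindrome (u [m \<rightarrow> j + ?l])"
    using LeastI_ex[of "\<lambda>m. i \<le> m \<and> palindrome (u [m \<rightarrow> j + ?l])"] last unfolding m_def by blast+
  have "m \<le> j + ?l - 1" unfolding m_def using last by (intro Least_le) simp
  then have mj: "m < j + ?l" using ij(1) by simp
  have least: "\<forall>n. i \<le> n \<longrightarrow> n < m \<longrightarrow> \<not> palindrome (u [n \<rightarrow> j + ?l])"
    unfolding m_def using not_less_Least by blast
  have uni: "\<not> occurrence u (u [m \<rightarrow> j + ?l]) x" if "i \<le> x" "x < m" for x
    using rich[unfolded rich_iff_unioccurrent_position] that mj m(2) least by blast
  have "m = i"
  proof (cases "m < j")
    case True
    have "occurrence_or_rev u w (m + j - j)"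
      using m(2) ij(3) True by (intro occurrence_or_rev_reflect) auto
    then show ?thesis using gap[of m] m(1) True by (cases "m = i") auto
  next
    case False
    define b where "b = u [j \<rightarrow> j + ?l]"
    have b: "w = b \<or> rev w = b"
      using ij(3) unfolding occurrence_or_rev_def b_def occurrence_def by auto
    then have "occurrence u b i \<or> occurrence u (rev b) i"
      using ij(2) unfolding occurrence_or_rev_def by auto
    then show ?thesis
    proof
      assume "occurrence u b i"
      then have "occurrence u (u [m \<rightarrow> j + ?l]) (i + (m - j))"
        using False mj unfolding b_def
        by (subst occurrence_subsequence_shift) (auto simp: occurrence_subsequence)
      moreover have "i + (m - j) < m" using ij(1) False by arith
      ultimately show ?thesis using uni by force
    next
      \<comment> \<open>A palindromic suffix of \<open>b\<close> is a prefix of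
        \<open>rev b\<close>, so here the early copy starts at \<open>i\<close> itself.\<close>
      assume ri: "occurrence u (rev b) i"
      have "u (i + t) = (u [m \<rightarrow> j + ?l]) ! t" if t: "t < j + ?l - m" for t
      proof -
        have "u (i + t) = rev b ! t" using ri t False unfolding occurrence_iff b_def by simp
        also have "\<dots> = u (j + (?l - Suc t))" using t False unfolding b_def by (simp add: rev_nth)
        also have "\<dots> = u (m + t)"
          using m(2)[unfolded palindrome_subsequence_iff, rule_format, of "j + (?l - Suc t)" "m + t"]
            t False by simp
        finally show ?thesis using t by simp
      qed
      then have "occurrence u (u [m \<rightarrow> j + ?l]) i" by (simp add: occurrence_iff)
      then show ?thesis using uni[of i] m(1) by (cases "m = i") auto
    qed
  qed
  then show ?thesis using m(2) by simp
qed

text \<open>If the longest palindromic suffix had an earlier copy, the last such copy before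
  \<open>m\<close> and the one at \<open>m\<close> would bound a complete return. Being a
  palindrome, that return is a longer palindromic suffix.\<close>

lemma rich_if_complete_returns_palindromic:
  assumes "\<And>p i j. \<lbrakk>p \<in> language u; palindrome p; successive_occurrences u p i j\<rbrakk> \<Longrightarrow>
             palindrome (u [i \<rightarrow> j + length p])"
  shows "rich u"
  unfolding rich_iff_unioccurrent_position
proof (intro allI impI notI)
  fix i m j x
  assume h: "i \<le> x" "x < m" "m < j" "palindrome (u [m \<rightarrow> j])"
    "\<forall>n. i \<le> n \<longrightarrow> n < m \<longrightarrow> \<not> palindrome (u [n \<rightarrow> j])" "occurrence u (u [m \<rightarrow> j]) x"
  define X where "X = {x. x < m \<and> occurrence u (u [m \<rightarrow> j]) x}"
  have fin: "finite X" and x: "x \<in> X" using h by (auto simp: X_def)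
  have mx: "Max X \<in> X" "i \<le> Max X"
    using Max_in[OF fin] Max_ge[OF fin] x h(1) by (blast, meson le_trans)
  then have "successive_occurrences u (u [m \<rightarrow> j]) (Max X) m"
    using Max_ge[OF fin]
    by (auto simp: successive_occurrences_def occurrence_subsequence X_def leD)
  from assms[OF _ h(4) this] have "palindrome (u [Max X \<rightarrow> j])" using h by simp
  moreover have "Max X < m" using mx(1) by (simp add: X_def)
  ultimately show False using h(5)[rule_format, OF mx(2)] by simp
qed

subsection \<open>Towers of palindromes\<close>

text \<open>\<open>recurrent\<close> promises two occurrences without saying where. Applied to the
  prefix of \<open>u\<close> that ends with the given copy of \<open>w\<close>, it yields a copy of
  this prefix at some \<open>y > 0\<close>, hence \<open>w\<close> at \<open>y + i\<close>.\<close>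

lemma occurrence_next:
  assumes "recurrent u" and "occurrence u w i"
  obtains j where "i < j" "occurrence u w j"
proof -
  obtain x y where xy: "x < y" "occurrence u (u [0 \<rightarrow> i + length w]) y"
    using assms(1) subsequence_in_language unfolding recurrent_def by blast
  have "occurrence u w (y + i)"
    using occurrence_subsequence_shift[OF xy(2), of i w] assms(2) by simp
  then show ?thesis using that[of "y + i"] xy(1) by simp
qed

lemma infinite_occurrences:
  assumes "recurrent u" and "w \<in> language u"
  shows "infinite {i. occurrence u w i}"
proof
  assume fin: "finite {i. occurrence u w i}"
  have ne: "{i. occurrence u w i} \<noteq> {}" using assms(2) by (auto simp: language_def)
  have "occurrence u w (Max {i. occurrence u w i})" using Max_in[OF fin ne] by simp
  then obtain j where "Max {i. occurrence u w i} < j" "occurrence u w j"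
    using occurrence_next[OF assms(1)] by blast
  then show False using Max_ge[OF fin, of j] by simp
qed

lemma uniformly_recurrent_window:
  assumes "uniformly_recurrent u" and "w \<in> language u"
  obtains N where "\<And>i. \<exists>j\<ge>i. j \<le> i + N \<and> occurrence u w j"
proof -
  obtain N where N: "\<And>i j. successive_occurrences u w i j \<Longrightarrow> j - i \<le> N"
    using assms(1)[unfolded uniformly_recurrent_def, THEN conjunct2, rule_format, OF assms(2)] by blast
  obtain i0 where i0: "occurrence u w i0" using assms(2) by (auto simp: language_def)
  \<comment> \<open>\<open>N\<close> bounds only gaps between occurrences; the summand
    \<open>i0\<close> covers the case where the next occurrence is no later than the known
    one.\<close>
  have "\<exists>j\<ge>i. j \<le> i + (i0 + N) \<and> occurrence u w j" for i
  proof -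
    define j where "j = (LEAST j. i \<le> j \<and> occurrence u w j)"
    have "infinite {i. occurrence u w i}"
      using assms infinite_occurrences unfolding uniformly_recurrent_def by blast
    then have "\<exists>j\<ge>i. occurrence u w j" by (simp add: infinite_nat_iff_unbounded_le)
    then have j: "i \<le> j \<and> occurrence u w j"
      unfolding j_def by (rule LeastI_ex)
    have least: "\<And>m. i \<le> m \<Longrightarrow> m < j \<Longrightarrow> \<not> occurrence u w m"
      unfolding j_def using not_less_Least by blast
    show ?thesis
    proof (cases "j \<le> i0")
      case True
      then show ?thesis using j by (intro exI[of _ j]) simp
    next
      case False
      define X where "X = {x. x < j \<and> occurrence u w x}"
      have fin: "finite X" and i0X: "i0 \<in> X" using False i0 by (auto simp: X_def)
      have mx: "Max X < j" "occurrence u w (Max X)"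
        using Max_in[OF fin] i0X unfolding X_def by blast+
      have gap: "\<not> occurrence u w m" if "Max X < m" "m < j" for m
      proof
        assume "occurrence u w m"
        then have "m \<in> X" using that(2) by (simp add: X_def)
        then show False using Max_ge[OF fin] that(1) by fastforce
      qed
      have "Max X < i" using least[of "Max X"] mx by (meson not_le)
      moreover have "j - Max X \<le> N"
        by (rule N) (use mx gap j in \<open>simp add: successive_occurrences_def\<close>)
      ultimately show ?thesis using j by (intro exI[of _ j]) simp
    qed
  qed
  then show ?thesis using that by blast
qed

section \<open>Bricks, palindromic cores and towers\<close>

definition bricks :: "'a word \<Rightarrow> 'a list \<Rightarrow> 'a list set" where
  "bricks u w = {u [i \<rightarrow> j + length w] | i j. consecutive u w i j}"

text \<open>\<open>THE\<close> denotes a genuine extension only where palindromic extensions are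
  unique, as in \<open>tower_Suc\<close>.\<close>

primrec tower :: "'a word \<Rightarrow> 'a list \<Rightarrow> nat \<Rightarrow> 'a list" where
  "tower u c 0 = c"
| "tower u c (Suc n) = (THE v. v \<in> palindromic_extensions u (tower u c n))"

text \<open>The possible centres of palindromes: \<open>[]\<close> for even length, a single letter
  for odd length.\<close>

definition cores :: "'a set \<Rightarrow> 'a list set" where
  "cores A = insert [] ((\<lambda>a. [a]) ` A)"

lemma card_cores: "finite A \<Longrightarrow> card (cores A) = Suc (card A)"
  unfolding cores_def by (subst card_insert_disjoint) (auto simp: card_image inj_on_def)

lemma length_core: "c \<in> cores A \<Longrightarrow> length c \<le> 1"
  by (auto simp: cores_def)

lemma palindrome_Cons_snoc: "palindrome (a # p @ [b]) \<longleftrightarrow> a = b \<and> palindrome p"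
  by (auto simp: palindrome_def)

lemma in_language_middle: "x @ w @ y \<in> language u \<Longrightarrow> w \<in> language u"
proof -
  assume "x @ w @ y \<in> language u"
  then obtain i where i: "occurrence u (x @ w @ y) i" by (auto simp: language_def)
  have "u (i + length x + t) = w ! t" if "t < length w" for t
    using i[unfolded occurrence_iff, rule_format, of "length x + t"] that
    by (simp add: nth_append add.assoc)
  then have "occurrence u w (i + length x)" by (simp add: occurrence_iff)
  then show ?thesis by (auto simp: language_def)
qed

lemma sublist_palindrome_iff:
  "palindrome p \<Longrightarrow> sublist (rev w) p \<longleftrightarrow> sublist w p"
  by (metis palindrome_def sublist_rev)

lemma sublist_palindrome_iff_occurrence_or_rev:
  assumes "palindrome (u [i \<rightarrow> j])" and "i \<le> j"
  shows "sublist w (u [i \<rightarrow> j]) \<longleftrightarrow> (\<exists>x\<ge>i. x + length w \<le> j \<and> occurrence_or_rev u w x)"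
  using sublist_palindrome_iff[OF assms(1), of w] sublist_subsequence_iff[OF assms(2), of w u]
    sublist_subsequence_iff[OF assms(2), of "rev w" u]
  unfolding occurrence_or_rev_def by auto

locale unique_palindromic_extensions =
  fixes A :: "'a set" and u :: "'a word"
  assumes word: "infinite_word_over A u"
    and recurrent: "uniformly_recurrent u"
    and unique_extension:
      "\<forall>w\<in>language u. palindrome w \<longrightarrow> (\<exists>!v. v \<in> palindromic_extensions u w)"
begin

lemma finite_alphabet: "finite A"
  using word by (simp add: infinite_word_over_def)

lemma singleton_in_language: "[a] \<in> language u \<longleftrightarrow> a \<in> A"
  using word by (auto simp: infinite_word_over_def language_def occurrence_iff)

lemma tower_Suc:
  assumes "tower u c n \<in> language u" "palindrome (tower u c n)"
  shows "tower u c (Suc n) \<in> palindromic_extensions u (tower u c n)"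
proof -
  have "\<exists>!v. v \<in> palindromic_extensions u (tower u c n)" using unique_extension assms by blast
  then show ?thesis unfolding tower.simps by (rule theI')
qed

lemma tower_palindrome:
  assumes "c \<in> cores A"
  shows "tower u c n \<in> language u \<and> palindrome (tower u c n)"
proof (induction n)
  case 0
  have "[] \<in> language u" using occurrence_Nil by (simp only: language_def mem_Collect_eq) blast
  then show ?case using assms by (auto simp: cores_def singleton_in_language)
next
  case (Suc n)
  then show ?case
    using tower_Suc[of c n] unfolding palindromic_extensions_def
    by (auto simp: palindrome_Cons_snoc simp del: tower.simps)
qed

lemma tower_SucE:
  assumes "c \<in> cores A"
  obtains a where "tower u c (Suc n) = a # tower u c n @ [a]"
  using tower_Suc[of c n] tower_palindrome[OF assms, of n]
  unfolding palindromic_extensions_def by blast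

lemma length_tower: "c \<in> cores A \<Longrightarrow> length (tower u c n) = length c + 2 * n"
proof (induction n)
  case (Suc n)
  then obtain a where "tower u c (Suc n) = a # tower u c n @ [a]" using tower_SucE by blast
  then show ?case using Suc by (simp del: tower.simps)
qed simp

text \<open>Since cores have length at most 1, the length \<open>length c + 2 * m\<close> determines
  \<open>m\<close>; peeling off outer letters then identifies the cores.\<close>

lemma tower_inject:
  assumes "c \<in> cores A" "d \<in> cores A" "tower u c m = tower u d n"
  shows "c = d \<and> m = n"
proof -
  have "length c + 2 * m = length d + 2 * n" using assms length_tower by metis
  then have "m = n" using length_core[OF assms(1)] length_core[OF assms(2)] by presburger
  moreover have "c = d" if "tower u c n = tower u d n"
    using that
  proof (induction n)
    case (Suc n)
    obtain a where a: "tower u c (Suc n) = a # tower u c n @ [a]" by (rule tower_SucE[OF assms(1)])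
    obtain b where b: "tower u d (Suc n) = b # tower u d n @ [b]" by (rule tower_SucE[OF assms(2)])
    have "tower u c n = tower u d n" using Suc.prems unfolding a b by simp
    then show ?case by (rule Suc.IH)
  qed simp
  ultimately show ?thesis using assms(3) by simp
qed

text \<open>Stripping the outer letters leaves a shorter palindrome, which is a tower level by
  induction; uniqueness of its extension makes \<open>p\<close> the next level.\<close>

lemma palindrome_is_tower:
  assumes "p \<in> language u" "palindrome p"
  shows "\<exists>c\<in>cores A. \<exists>n. p = tower u c n"
  using assms
proof (induction p rule: length_induct)
  case (1 p)
  consider "length p \<le> 1" | a q b where "p = a # q @ [b]"
    by (metis append_butlast_last_id length_0_conv length_Cons list.exhaust list.size(3) nle_le
        not_less_eq_eq One_nat_def le_0_eq)
  then show ?case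
  proof cases
    case 1
    then have "p \<in> cores A"
      using "1.prems" by (cases p) (auto simp: cores_def singleton_in_language)
    then show ?thesis by (metis tower.simps(1))
  next
    case 2
    have q: "palindrome q" "q \<in> language u" and ab: "a = b"
      using "1.prems" 2 in_language_middle[of "[a]" q "[b]"] by (auto simp: palindrome_Cons_snoc)
    have "length q < length p" using 2 by simp
    then obtain c n where c: "c \<in> cores A" "q = tower u c n" using "1.IH" q by blast
    have "p \<in> palindromic_extensions u (tower u c n)"
      using "1.prems"(1) 2 ab c by (auto simp: palindromic_extensions_def)
    moreover have "tower u c (Suc n) \<in> palindromic_extensions u (tower u c n)"
      using tower_Suc tower_palindrome c(1) by blast
    ultimately have "p = tower u c (Suc n)"
      using unique_extension tower_palindrome[OF c(1), of n] by blast
    then show ?thesis using c(1) by blast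
  qed
qed

lemma tower_nested:
  assumes "c \<in> cores A"
  shows "\<exists>s. length s = d \<and> tower u c (m + d) = s @ tower u c m @ rev s"
proof (induction d)
  case (Suc d)
  then obtain s where "length s = d" "tower u c (m + d) = s @ tower u c m @ rev s" by blast
  moreover obtain a where "tower u c (Suc (m + d)) = a # tower u c (m + d) @ [a]"
    using tower_SucE[OF assms] .
  ultimately show ?case by (intro exI[of _ "a # s"]) (simp del: tower.simps)
qed simp

text \<open>Uniform recurrence puts \<open>w\<close> into every sufficiently long factor, and the
  levels of a tower grow without bound.\<close>

lemma tower_contains_factor:
  assumes "c \<in> cores A" "w \<in> language u"
  shows "\<exists>n. sublist w (tower u c n)"
proof -
  obtain N where N: "\<And>i. \<exists>j\<ge>i. j \<le> i + N \<and> occurrence u w j"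
    using uniformly_recurrent_window[OF recurrent assms(2)] by blast
  let ?T = "tower u c (N + length w)"
  obtain i where i: "u [i \<rightarrow> i + length ?T] = ?T"
    using in_languageE tower_palindrome[OF assms(1)] by blast
  obtain j where j: "i \<le> j" "j \<le> i + N" "occurrence u w j" using N by blast
  have "sublist w (u [i \<rightarrow> i + length ?T])"
    using j length_tower[OF assms(1)] by (subst sublist_subsequence_iff) (auto intro!: exI[of _ j])
  then show ?thesis unfolding i by blast
qed

text \<open>An occurrence of \<open>w\<close> or its reversal strictly inside would already lie in
  the level below. So one stands at an end, and by reflection at both ends; as the tower avoids
  \<open>w\<close>, these are different positions.\<close>

lemma minimal_tower_is_brick:
  assumes c: "c \<in> cores A" and w: "\<And>m. tower u c m \<noteq> w"
    and sub: "sublist w (tower u c n)" and min: "\<And>m. m < n \<Longrightarrow> \<not> sublist w (tower u c m)"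
  shows "tower u c n \<in> bricks u w"
proof -
  let ?T = "tower u c n"
  let ?l = "length w"
  obtain i where i: "u [i \<rightarrow> i + length ?T] = ?T"
    using in_languageE tower_palindrome[OF c] by blast
  define j where "j = i + length ?T - ?l"
  have "?l \<le> length ?T" using sub by (rule sublist_length_le)
  moreover have "w = ?T" if "?l = length ?T" using sub that by (auto simp: sublist_def)
  then have "?l \<noteq> length ?T" using w[of n] by metis
  ultimately have ij: "i < j" "i + length ?T = j + ?l" by (auto simp: j_def)
  have T: "?T = u [i \<rightarrow> j + ?l]" using i ij by simp
  have pal: "palindrome (u [i \<rightarrow> j + ?l])" using tower_palindrome[OF c, of n] T by simp
  have gap: "\<not> occurrence_or_rev u w x" if x: "i < x" "x < j" for x
  proof
    assume occ: "occurrence_or_rev u w x"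
    \<comment> \<open>Room for \<open>x\<close> strictly between the ends shows that the level is
      not a core, so there is a level below it.\<close>
    have "length ?T \<ge> 2" using x ij by simp
    then have "n \<noteq> 0" using length_core[OF c] by (intro notI) simp
    then obtain m where m: "n = Suc m" by (cases n) auto
    obtain a where a: "?T = a # tower u c m @ [a]" using tower_SucE[OF c] m by metis
    have len: "length ?T = length (tower u c m) + 2" unfolding a by simp
    have "tower u c m = take (length (tower u c m)) (drop 1 ?T)" unfolding a by simp
    also have "\<dots> = u [i + 1 \<rightarrow> j + ?l - 1]"
    proof -
      have "j + ?l - 1 = i + 1 + length (tower u c m)" using ij(2) len by simp
      moreover have "min (i + 1 + length (tower u c m)) (j + ?l) = i + 1 + length (tower u c m)"
        using ij(2) len by simp
      ultimately show ?thesis unfolding T by (simp only: subsequence_drop subsequence_take)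
    qed
    finally have Tm: "tower u c m = u [i + 1 \<rightarrow> j + ?l - 1]" .
    have "sublist w (u [i + 1 \<rightarrow> j + ?l - 1])"
      using tower_palindrome[OF c, of m] occ x unfolding Tm
      by (subst sublist_palindrome_iff_occurrence_or_rev) (auto intro!: exI[of _ x])
    then show False using min[of m] m unfolding Tm by simp
  qed
  obtain x where x: "i \<le> x" "x \<le> j" "occurrence_or_rev u w x"
    using sub ij(1) unfolding T
    by (subst (asm) sublist_palindrome_iff_occurrence_or_rev[OF pal]) auto
  have "x = i \<or> x = j" using gap[of x] x by fastforce
  moreover have "occurrence_or_rev u w (i + j - x)"
    using occurrence_or_rev_reflect[OF pal x(3,1,2)] .
  ultimately have "occurrence_or_rev u w i" "occurrence_or_rev u w j" using x(3) by auto
  then have "consecutive u w i j" using ij gap by (simp add: consecutive_def)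
  then show ?thesis using T unfolding bricks_def by blast
qed

text \<open>The converse: level \<open>m\<close> is the brick with \<open>n - m\<close> letters
  removed at each end, so a copy of \<open>w\<close> in it would start strictly between
  \<open>i\<close> and \<open>j\<close>.\<close>

lemma palindromic_brick_minimal:
  assumes c: "c \<in> cores A" and brick: "tower u c n \<in> bricks u w"
  shows "sublist w (tower u c n)" and "m < n \<Longrightarrow> \<not> sublist w (tower u c m)"
    and "tower u c m \<noteq> w"
proof -
  let ?l = "length w"
  obtain i j where T: "tower u c n = u [i \<rightarrow> j + ?l]" and cons: "consecutive u w i j"
    using brick unfolding bricks_def by blast
  have ij: "i < j" "occurrence_or_rev u w i"
    and gap: "\<And>x. i < x \<Longrightarrow> x < j \<Longrightarrow> \<not> occurrence_or_rev u w x"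
    using cons unfolding consecutive_def by blast+
  have pal: "palindrome (u [i \<rightarrow> j + ?l])" using tower_palindrome[OF c, of n] T by simp
  show "sublist w (tower u c n)"
  proof -
    have "\<exists>x\<ge>i. x + ?l \<le> j + ?l \<and> occurrence_or_rev u w x" using ij by (intro exI[of _ i]) simp
    moreover have "i \<le> j + ?l" using ij(1) by simp
    ultimately show ?thesis
      unfolding T by (simp only: sublist_palindrome_iff_occurrence_or_rev[OF pal])
  qed
  have smaller: "\<not> sublist w (tower u c m)" if "m < n" for m
  proof
    assume sub: "sublist w (tower u c m)"
    have "m + (n - m) = n" using that by simp
    with tower_nested[OF c, of "n - m" m]
    obtain s where s: "length s = n - m" "tower u c n = s @ tower u c m @ rev s" by metis
    have len: "j + ?l - i = 2 * (n - m) + length (tower u c m)"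
      using arg_cong[OF s(2), of length] s(1) unfolding T by simp
    have "tower u c m = take (length (tower u c m)) (drop (n - m) (tower u c n))"
      unfolding s(2) using s(1) by simp
    also have "\<dots> = u [i + (n - m) \<rightarrow> j + ?l - (n - m)]"
    proof -
      have "min (i + (n - m) + length (tower u c m)) (j + ?l) = j + ?l - (n - m)"
        using len ij(1) by linarith
      then show ?thesis unfolding T by (simp only: subsequence_drop subsequence_take)
    qed
    finally have Tm: "tower u c m = u [i + (n - m) \<rightarrow> j + ?l - (n - m)]" .
    have "i + (n - m) \<le> j + ?l - (n - m)" using len ij(1) by simp
    then obtain x where x: "i + (n - m) \<le> x" "x + ?l \<le> j + ?l - (n - m)" "occurrence_or_rev u w x"
      using sub tower_palindrome[OF c, of m] unfolding Tm
      by (subst (asm) sublist_palindrome_iff_occurrence_or_rev) auto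
    then show False using gap[of x] that by simp
  qed
  then show "m < n \<Longrightarrow> \<not> sublist w (tower u c m)" .
  show "tower u c m \<noteq> w"
  proof
    assume m: "tower u c m = w"
    have "length (tower u c m) < length (tower u c n)" unfolding m T using ij(1) by simp
    then have "m < n" by (simp add: length_tower[OF c])
    then show False using smaller[of m] m by simp
  qed
qed

text \<open>The bijection sends a core to the first level of its tower that contains
  \<open>w\<close>. A tower through \<open>w\<close> is left out because that first level is
  \<open>w\<close> itself, too short for a brick.\<close>

lemma card_palindromic_bricks_cores:
  assumes w: "w \<in> language u"
  shows "card {v \<in> bricks u w. palindrome v} = card {c \<in> cores A. \<forall>m. tower u c m \<noteq> w}"
proof -
  define N where "N c = (LEAST n. sublist w (tower u c n))" for c
  have N: "sublist w (tower u c (N c))" "\<And>m. m < N c \<Longrightarrow> \<not> sublist w (tower u c m)"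
    if "c \<in> cores A" for c
    using LeastI_ex[OF tower_contains_factor[OF that w]] not_less_Least unfolding N_def by auto
  have "bij_betw (\<lambda>c. tower u c (N c)) {c \<in> cores A. \<forall>m. tower u c m \<noteq> w}
          {v \<in> bricks u w. palindrome v}"
  proof (intro bij_betw_imageI inj_onI set_eqI iffI)
    fix c d
    assume "c \<in> {c \<in> cores A. \<forall>m. tower u c m \<noteq> w}" "d \<in> {c \<in> cores A. \<forall>m. tower u c m \<noteq> w}"
      "tower u c (N c) = tower u d (N d)"
    then show "c = d" using tower_inject[of c d "N c" "N d"] by simp
  next
    fix v assume "v \<in> (\<lambda>c. tower u c (N c)) ` {c \<in> cores A. \<forall>m. tower u c m \<noteq> w}"
    then obtain c where c: "c \<in> cores A" "\<And>m. tower u c m \<noteq> w" "v = tower u c (N c)" by blast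
    show "v \<in> {v \<in> bricks u w. palindrome v}"
      using minimal_tower_is_brick[OF c(1,2) N[OF c(1)]] tower_palindrome[OF c(1)] c(3) by simp
  next
    fix v assume v: "v \<in> {v \<in> bricks u w. palindrome v}"
    then have "v \<in> language u" by (auto simp: bricks_def)
    moreover have "palindrome v" using v by simp
    ultimately obtain c n where c: "c \<in> cores A" "v = tower u c n"
      using palindrome_is_tower by blast
    have brick: "tower u c n \<in> bricks u w" using v c(2) by simp
    have "N c = n"
      unfolding N_def
    proof (rule Least_equality)
      show "sublist w (tower u c n)" using palindromic_brick_minimal[OF c(1) brick] by simp
    next
      fix m assume "sublist w (tower u c m)"
      then show "n \<le> m" using palindromic_brick_minimal(2)[OF c(1) brick] by (meson not_le)
    qed
    moreover have "\<And>m. tower u c m \<noteq> w" by (rule palindromic_brick_minimal(3)[OF c(1) brick])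
    ultimately show "v \<in> (\<lambda>c. tower u c (N c)) ` {c \<in> cores A. \<forall>m. tower u c m \<noteq> w}"
      using c by blast
  qed
  from bij_betw_same_card[OF this] show ?thesis by (rule sym)
qed

text \<open>Of the \<open>Suc (card A)\<close> cores, exactly one has a tower through
  \<open>w\<close> if \<open>w\<close> is a palindrome, and none otherwise.\<close>

lemma card_palindromic_bricks:
  assumes w: "w \<in> language u"
  shows "card {v \<in> bricks u w. palindrome v} = (if palindrome w then card A else Suc (card A))"
proof (cases "palindrome w")
  case True
  then obtain c n where c: "c \<in> cores A" "w = tower u c n" using palindrome_is_tower[OF w] by blast
  have "{d \<in> cores A. \<forall>m. tower u d m \<noteq> w} = cores A - {c}"
  proof (intro set_eqI)
    fix d
    have "(\<forall>m. tower u d m \<noteq> w) \<longleftrightarrow> d \<noteq> c" if "d \<in> cores A"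
      unfolding c(2) using tower_inject[OF that c(1)] by metis
    then show "d \<in> {d \<in> cores A. \<forall>m. tower u d m \<noteq> w} \<longleftrightarrow> d \<in> cores A - {c}" by simp blast
  qed
  then show ?thesis
    unfolding card_palindromic_bricks_cores[OF w]
    using True c(1) card_cores[OF finite_alphabet] finite_alphabet by simp
next
  case False
  then have "{c \<in> cores A. \<forall>m. tower u c m \<noteq> w} = cores A"
    using tower_palindrome by blast
  then show ?thesis
    unfolding card_palindromic_bricks_cores[OF w]
    using False card_cores[OF finite_alphabet] by simp
qed

end

subsection \<open>Return words\<close>

lemma subsequence_concat: "i \<le> j \<Longrightarrow> j \<le> k \<Longrightarrow> u [i \<rightarrow> j] @ u [j \<rightarrow> k] = u [i \<rightarrow> k]"
  unfolding subsequence_def map_append[symmetric] by (metis le_Suc_ex upt_add_eq_append)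

lemma bricks_palindrome_eq_image:
  assumes "palindrome w"
  shows "bricks u w = (\<lambda>r. r @ w) ` return_words u w"
proof -
  have eq: "u [i \<rightarrow> j + length w] = u [i \<rightarrow> j] @ w" if "successive_occurrences u w i j" for i j
  proof -
    have "i \<le> j" "u [j \<rightarrow> j + length w] = w"
      using that by (auto simp: successive_occurrences_def occurrence_def)
    then show ?thesis using subsequence_concat[of i j "j + length w" u] by simp
  qed
  have "bricks u w = (\<lambda>(i, j). u [i \<rightarrow> j + length w]) ` {(i, j). successive_occurrences u w i j}"
    unfolding bricks_def consecutive_palindrome[OF assms] by auto
  also have "\<dots> = (\<lambda>(i, j). u [i \<rightarrow> j] @ w) ` {(i, j). successive_occurrences u w i j}"
    by (rule image_cong) (auto simp: eq)
  also have "\<dots> = (\<lambda>r. r @ w) ` return_words u w"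
    unfolding return_words_def by auto
  finally show ?thesis .
qed

lemma card_bricks_palindrome:
  "palindrome w \<Longrightarrow> card (bricks u w) = card (return_words u w)"
  by (simp add: bricks_palindrome_eq_image card_image inj_on_def)

text \<open>Used to count return words by edges over a common index set.\<close>

lemma card_image_eq_if_same_kernel:
  assumes "\<And>x y. x \<in> I \<Longrightarrow> y \<in> I \<Longrightarrow> f x = f y \<longleftrightarrow> g x = g y"
  shows "card (f ` I) = card (g ` I)"
proof -
  define h where "h z = g (inv_into I f z)" for z
  have h: "h (f x) = g x" if "x \<in> I" for x
    using assms[of "inv_into I f (f x)" x] that
    by (simp add: h_def inv_into_into f_inv_into_f)
  then have "inj_on h (f ` I)" using assms by (auto intro!: inj_onI)
  moreover have "h ` f ` I = g ` I" using h by (auto simp: image_image)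
  ultimately show ?thesis by (metis card_image)
qed

text \<open>Carries the count of bricks and edges from initial segments of the walk to the whole
  walk.\<close>

lemma finite_range_initial_segment:
  fixes f :: "nat \<Rightarrow> 'b"
  assumes "finite (range f)"
  obtains N where "\<And>n. N \<le> n \<Longrightarrow> f ` {..<n} = range f"
proof -
  obtain C where C: "finite C" "range f = f ` C"
    using finite_subset_image[OF assms, of f UNIV] by auto
  obtain N where N: "C \<subseteq> {..<N}" using C(1) finite_nat_iff_bounded by blast
  have "f ` {..<n} = range f" if "N \<le> n" for n
  proof -
    have "C \<subseteq> {..<n}" using N that by auto
    then show ?thesis using C(2) by blast
  qed
  then show ?thesis using that by blast
qed

section \<open>Transport of consecutive occurrences\<close>

lemma consecutive_right_unique: "consecutive u w i j \<Longrightarrow> consecutive u w i k \<Longrightarrow> j = k"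
  unfolding consecutive_def by (meson linorder_neqE_nat)

lemma consecutive_left_unique: "consecutive u w i k \<Longrightarrow> consecutive u w j k \<Longrightarrow> i = j"
  unfolding consecutive_def by (meson linorder_neqE_nat)

lemma consecutive_shift:
  assumes "consecutive u w a b" and occ: "occurrence u (u [a \<rightarrow> b + length w]) x"
  shows "consecutive u w x (x + (b - a))"
proof -
  have shift: "occurrence_or_rev u w (x + d) \<longleftrightarrow> occurrence_or_rev u w (a + d)" if "a + d \<le> b" for d
    using occurrence_subsequence_shift[OF occ, of d w] occurrence_subsequence_shift[OF occ, of d "rev w"]
      that by (simp add: occurrence_or_rev_def)
  have ab: "a < b" "occurrence_or_rev u w a" "occurrence_or_rev u w b"
    and gap: "\<And>m. a < m \<Longrightarrow> m < b \<Longrightarrow> \<not> occurrence_or_rev u w m"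
    using assms(1) unfolding consecutive_def by blast+
  have "\<not> occurrence_or_rev u w m" if "x < m" "m < x + (b - a)" for m
    using shift[of "m - x"] gap[of "a + (m - x)"] that ab(1) by simp
  then show ?thesis
    using ab shift[of 0] shift[of "b - a"] unfolding consecutive_def by simp
qed

lemma consecutive_reflect:
  assumes "palindrome (u [a \<rightarrow> b + length w])" and "consecutive u w i j" and "a \<le> i" and "j \<le> b"
  shows "consecutive u w (a + b - j) (a + b - i)"
proof -
  have ij: "i < j" "occurrence_or_rev u w i" "occurrence_or_rev u w j"
    and gap: "\<And>m. i < m \<Longrightarrow> m < j \<Longrightarrow> \<not> occurrence_or_rev u w m"
    using assms(2) unfolding consecutive_def by blast+
  have "\<not> occurrence_or_rev u w m" if m: "a + b - j < m" "m < a + b - i" for m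
  proof
    assume "occurrence_or_rev u w m"
    moreover have "a \<le> m" "m \<le> b" using m assms(3,4) by linarith+
    ultimately have "occurrence_or_rev u w (a + b - m)"
      by (rule occurrence_or_rev_reflect[OF assms(1)])
    moreover have "i < a + b - m" "a + b - m < j" using m assms(3,4) ij(1) by linarith+
    ultimately show False using gap by blast
  qed
  moreover have "occurrence_or_rev u w (a + b - i)" "occurrence_or_rev u w (a + b - j)"
    using occurrence_or_rev_reflect[OF assms(1)] ij assms(3,4) by simp_all
  moreover have "a + b - j < a + b - i" using ij(1) assms(3,4) by simp
  ultimately show ?thesis unfolding consecutive_def by blast
qed

section \<open>The walk on the bricks of a nonpalindromic factor\<close>

locale rich_nonpalindrome =
  fixes u :: "'a word" and w :: "'a list"
  assumes recurrent: "recurrent u" and rich: "rich u"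
    and factor: "w \<in> language u" and nonpalindrome: "\<not> palindrome w"
begin

definition pos :: "nat \<Rightarrow> nat" where
  "pos = enumerate {i. occurrence_or_rev u w i}"

definition brick :: "nat \<Rightarrow> 'a list" where
  "brick n = u [pos n \<rightarrow> pos (Suc n) + length w]"

text \<open>An undirected edge: since \<open>w\<close> and \<open>rev w\<close> alternate along
  \<open>pos\<close>, the first component is always the brick that starts with \<open>w\<close>, so
  both directions of travel give the same pair.\<close>

definition edge :: "nat \<Rightarrow> 'a list \<times> 'a list" where
  "edge n = (if occurrence u w (pos n) then (brick n, brick (Suc n)) else (brick (Suc n), brick n))"

lemma infinite_positions: "infinite {i. occurrence_or_rev u w i}"
  using infinite_occurrences[OF recurrent factor]
  by (rule contrapos_nn) (auto simp: occurrence_or_rev_def elim!: finite_subset[rotated])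

lemma occurrence_pos: "occurrence_or_rev u w (pos n)"
  using enumerate_in_set[OF infinite_positions] by (simp add: pos_def)

lemma pos_less_iff [simp]: "pos m < pos n \<longleftrightarrow> m < n"
  using infinite_positions by (simp add: pos_def)

lemma pos_le_iff [simp]: "pos m \<le> pos n \<longleftrightarrow> m \<le> n"
  by (meson not_le pos_less_iff)

lemma pos_eq_iff [simp]: "pos m = pos n \<longleftrightarrow> m = n"
  by (simp add: eq_iff)

lemma occurrence_or_rev_iff_pos: "occurrence_or_rev u w i \<longleftrightarrow> (\<exists>n. i = pos n)"
  using enumerate_Ex[OF infinite_positions, of i] occurrence_pos by (auto simp: pos_def)

lemma consecutive_pos: "consecutive u w (pos n) (pos (Suc n))"
  unfolding consecutive_def by (auto simp: occurrence_pos occurrence_or_rev_iff_pos)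

lemma consecutive_iff_pos: "consecutive u w i j \<longleftrightarrow> (\<exists>n. i = pos n \<and> j = pos (Suc n))"
proof
  assume cons: "consecutive u w i j"
  then obtain n where "i = pos n"
    unfolding consecutive_def occurrence_or_rev_iff_pos by blast
  then show "\<exists>n. i = pos n \<and> j = pos (Suc n)"
    using consecutive_right_unique[OF cons] consecutive_pos by blast
qed (auto simp: consecutive_pos)

lemma bricks_eq_range: "bricks u w = range brick"
  unfolding bricks_def brick_def consecutive_iff_pos by blast

lemma length_brick: "length (brick n) = pos (Suc n) - pos n + length w"
  using pos_less_iff[of n "Suc n"] by (simp add: brick_def)

lemma palindrome_brick: "palindrome (brick n)"
  unfolding brick_def by (rule rich_consecutive_palindrome[OF rich consecutive_pos])

text \<open>A brick is a palindrome, so it has \<open>w\<close> at one end when it has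
  \<open>rev w\<close> at the other; as \<open>w\<close> is no palindrome, both cannot stand at one
  position.\<close>

lemma occurrence_alternates: "occurrence u w (pos (Suc n)) \<longleftrightarrow> \<not> occurrence u w (pos n)"
proof -
  have not_both: "\<not> (occurrence u w i \<and> occurrence u (rev w) i)" for i
    using nonpalindrome by (auto simp: occurrence_def palindrome_def)
  have reflect: "occurrence u (rev v) (pos (Suc n))"
    if "occurrence u v (pos n)" "length v = length w" for v
    using occurrence_reflect[OF palindrome_brick[of n, unfolded brick_def] that(1)]
      pos_less_iff[of n "Suc n"] that(2) by simp
  show ?thesis
    using reflect[of w] reflect[of "rev w"] not_both[of "pos (Suc n)"] occurrence_pos[of n]
    unfolding occurrence_or_rev_def by auto
qed

lemma occurrence_brick:
  assumes "occurrence u (brick n) (pos m)"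
  shows "brick m = brick n" and "pos (Suc m) = pos m + (pos (Suc n) - pos n)"
proof -
  show eq: "pos (Suc m) = pos m + (pos (Suc n) - pos n)"
    using consecutive_shift[OF consecutive_pos assms[unfolded brick_def]] consecutive_pos
      consecutive_right_unique by blast
  have "pos (Suc m) + length w = pos m + length (brick n)"
    unfolding eq length_brick by linarith
  then show "brick m = brick n"
    using assms unfolding brick_def[of m] occurrence_def by simp
qed

lemma occurrence_brick_pos:
  assumes "occurrence u (brick n) i"
  obtains m where "i = pos m" "brick m = brick n"
proof -
  have "occurrence_or_rev u w i"
    using consecutive_shift[OF consecutive_pos assms[unfolded brick_def]]
    by (simp add: consecutive_def)
  then show ?thesis using that occurrence_brick(1) assms by (auto simp: occurrence_or_rev_iff_pos)
qed

lemma occurrence_brick_self: "occurrence u (brick n) (pos n)"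
  unfolding brick_def by (rule occurrence_subsequence)

text \<open>Bricks thus fall into two classes, by their beginning, and the walk alternates between
  them.\<close>

lemma occurrence_eq_if_brick_eq:
  assumes "brick m = brick n"
  shows "occurrence u w (pos m) \<longleftrightarrow> occurrence u w (pos n)"
  using occurrence_subsequence_shift[of u "pos n" "pos (Suc n) + length w" "pos m" 0 w]
    occurrence_brick_self[of m] assms pos_less_iff[of n "Suc n"]
  by (simp add: brick_def)

text \<open>\<open>brick m\<close> is a palindrome, so the stretch from its copy at
  \<open>pos m\<close> to the end of its copy at \<open>pos s\<close> is a complete return of a
  palindrome, itself a palindrome by richness. Reflection exchanges bricks \<open>m\<close> and
  \<open>s\<close>, hence also their inner neighbours \<open>Suc m\<close> and \<open>s - 1\<close>,
  and each brick equals its reversal.\<close>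

lemma first_return:
  assumes "m < s" and "brick m = brick s" and "\<And>t. m < t \<Longrightarrow> t < s \<Longrightarrow> brick t \<noteq> brick m"
  shows "Suc m < s" and "brick (Suc m) = brick (s - 1)"
proof -
  have "s \<noteq> Suc m"
    using occurrence_eq_if_brick_eq[OF assms(2)] occurrence_alternates[of m] by auto
  then show ms: "Suc m < s" using assms(1) by simp
  let ?l = "length w"
  have "successive_occurrences u (brick m) (pos m) (pos s)"
    unfolding successive_occurrences_def
  proof (intro conjI allI impI notI)
    show "pos m < pos s" using assms(1) by simp
    show "occurrence u (brick m) (pos m)" by (rule occurrence_brick_self)
    show "occurrence u (brick m) (pos s)" unfolding assms(2) by (rule occurrence_brick_self)
    fix x assume x: "pos m < x \<and> x < pos s" "occurrence u (brick m) x"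
    obtain t where "x = pos t" "brick t = brick m" using occurrence_brick_pos[OF x(2)] .
    then show False using x(1) assms(3)[of t] by simp
  qed
  then have "consecutive u (brick m) (pos m) (pos s)"
    using consecutive_palindrome[OF palindrome_brick] by blast
  from rich_consecutive_palindrome[OF rich this]
  moreover have "pos s + length (brick m) = pos (Suc s) + ?l"
    using pos_less_iff[of s "Suc s"] unfolding assms(2) length_brick by linarith
  ultimately have pal: "palindrome (u [pos m \<rightarrow> pos (Suc s) + ?l])" by simp
  \<comment> \<open>Subtraction from \<open>?M\<close> reflects starting positions in this
    palindrome; it takes \<open>pos m\<close> to \<open>pos (Suc s)\<close>, and uniqueness of left
    neighbours locates the images of the next two positions.\<close>
  let ?M = "pos m + pos (Suc s)"
  have "consecutive u w (?M - pos (Suc m)) (?M - pos m)"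
    by (rule consecutive_reflect[OF pal consecutive_pos]) (use assms(1) in simp_all)
  then have s: "?M - pos (Suc m) = pos s"
    using consecutive_pos[of s] consecutive_left_unique by fastforce
  have "consecutive u w (?M - pos (Suc (Suc m))) (?M - pos (Suc m))"
    by (rule consecutive_reflect[OF pal consecutive_pos]) (use ms in simp_all)
  moreover have "consecutive u w (pos (s - 1)) (pos s)"
    using consecutive_pos[of "s - 1"] ms by simp
  ultimately have s1: "?M - pos (Suc (Suc m)) = pos (s - 1)"
    unfolding s using consecutive_left_unique by blast
  have le: "pos (Suc m) \<le> pos (Suc (Suc m))" "pos (Suc (Suc m)) \<le> pos (Suc s)" "pos m \<le> pos (Suc m)"
    using ms by simp_all
  have "occurrence u (rev (brick (Suc m)))
      (pos m + (pos (Suc s) + ?l) - (pos (Suc m) + length (brick (Suc m))))"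
    using le by (intro occurrence_reflect[OF pal occurrence_brick_self]) (unfold length_brick, linarith+)
  moreover have "pos m + (pos (Suc s) + ?l) - (pos (Suc m) + length (brick (Suc m))) = pos (s - 1)"
    unfolding length_brick s1[symmetric] using le by linarith
  moreover have "rev (brick (Suc m)) = brick (Suc m)"
    using palindrome_brick by (simp add: palindrome_def)
  ultimately have "occurrence u (brick (Suc m)) (pos (s - 1))" by simp
  then show "brick (Suc m) = brick (s - 1)" by (simp add: occurrence_brick(1))
qed

text \<open>The tree property on initial segments: a step to a new brick uses a new edge, as earlier
  edges join visited bricks only; a step to an old brick retraces the edge by which that brick was
  last left.\<close>

lemma card_visited_bricks: "card (brick ` {..n}) = Suc (card (edge ` {..<n}))"
proof (induction n)
  case (Suc n)
  have bricks: "brick ` {..Suc n} = insert (brick (Suc n)) (brick ` {..n})"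
    by (simp add: atMost_Suc)
  have edges: "edge ` {..<Suc n} = insert (edge n) (edge ` {..<n})"
    by (simp add: lessThan_Suc)
  show ?case
  proof (cases "brick (Suc n) \<in> brick ` {..n}")
    case True
    \<comment> \<open>Taking the last earlier visit makes \<open>first_return\<close> applicable
      between \<open>m\<close> and \<open>Suc n\<close>.\<close>
    define X where "X = {m. m \<le> n \<and> brick m = brick (Suc n)}"
    have fin: "finite X" and ne: "X \<noteq> {}" using True by (auto simp: X_def)
    obtain m where m: "m = Max X" by blast
    have mX: "m \<le> n" "brick m = brick (Suc n)"
      using Max_in[OF fin ne] unfolding m[symmetric] by (simp_all add: X_def)
    have last: "brick t \<noteq> brick m" if "m < t" "t < Suc n" for t
    proof
      assume "brick t = brick m"
      then have "t \<in> X" using mX that by (simp add: X_def)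
      then show False using Max_ge[OF fin, of t] that(1) m by simp
    qed
    have fr: "m < n" "brick (Suc m) = brick n"
      using first_return[of m "Suc n"] mX last by simp_all
    \<comment> \<open>Steps \<open>m\<close> and \<open>n\<close> cross the same two bricks in
      opposite directions; the opposite starts make the ordered pairs agree.\<close>
    have "occurrence u w (pos n) \<longleftrightarrow> \<not> occurrence u w (pos m)"
      using occurrence_eq_if_brick_eq[OF fr(2)] occurrence_alternates[of m] by simp
    then have "edge n = edge m" using fr(2) mX(2) by (simp add: edge_def)
    then have "edge n \<in> edge ` {..<n}" using fr(1) by simp
    then show ?thesis unfolding bricks edges using True Suc.IH by (simp add: insert_absorb)
  next
    case False
    have "edge n \<notin> edge ` {..<n}"
    proof
      assume "edge n \<in> edge ` {..<n}"
      then obtain i where i: "i < n" "edge n = edge i" by auto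
      have "brick (Suc n) = brick i \<or> brick (Suc n) = brick (Suc i)"
        using i(2) by (auto simp: edge_def split: if_splits)
      then show False using False i(1) by auto
    qed
    then show ?thesis unfolding bricks edges using False Suc.IH by simp
  qed
qed simp

text \<open>Recurrence brings the walk back to \<open>brick n\<close>. The first return crosses the
  edge backwards, so an edge left from the \<open>rev w\<close> side is also crossed from the
  \<open>w\<close> side.\<close>

lemma edges_eq_image: "range edge = edge ` {n. occurrence u w (pos n)}"
proof -
  have "edge n \<in> edge ` {n. occurrence u w (pos n)}" for n
  proof (cases "occurrence u w (pos n)")
    case False
    obtain x where x: "pos n < x" "occurrence u (brick n) x"
      using occurrence_next[OF recurrent occurrence_brick_self] .
    obtain s0 where s0: "x = pos s0" "brick s0 = brick n" using occurrence_brick_pos[OF x(2)] .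
    define s where "s = (LEAST s. n < s \<and> brick s = brick n)"
    have "n < s0 \<and> brick s0 = brick n" using s0 x(1) by simp
    then have s: "n < s \<and> brick s = brick n" unfolding s_def by (rule LeastI)
    have "brick t \<noteq> brick n" if "n < t" "t < s" for t
      using not_less_Least[of t "\<lambda>s. n < s \<and> brick s = brick n"] that unfolding s_def by simp
    then have fr: "Suc n < s" "brick (Suc n) = brick (s - 1)"
      using first_return[of n s] s by simp_all
    have Suc: "Suc (s - 1) = s" using s by simp
    have "\<not> occurrence u w (pos s)" using occurrence_eq_if_brick_eq[of s n] s False by simp
    then have occ: "occurrence u w (pos (s - 1))" using occurrence_alternates[of "s - 1"] Suc by simp
    then have "edge (s - 1) = edge n" using False fr(2) s Suc by (simp add: edge_def)
    then show ?thesis using occ by (metis image_eqI mem_Collect_eq)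
  qed simp
  then show ?thesis by blast
qed

lemma successive_iff_pos:
  "successive_occurrences u w i j \<longleftrightarrow> (\<exists>n. occurrence u w (pos n) \<and> i = pos n \<and> j = pos (Suc (Suc n)))"
proof
  assume succ: "successive_occurrences u w i j"
  then have ij: "i < j" "occurrence u w i" "occurrence u w j"
    and gap: "\<And>m. i < m \<Longrightarrow> m < j \<Longrightarrow> \<not> occurrence u w m"
    unfolding successive_occurrences_def by blast+
  obtain n t where n: "i = pos n" and t: "j = pos t"
    using ij(2,3) occurrence_or_rev_iff_pos unfolding occurrence_or_rev_def by meson
  have "t \<noteq> Suc n" using ij(2,3) occurrence_alternates[of n] unfolding n t by auto
  moreover have "\<not> Suc (Suc n) < t"
    using gap[of "pos (Suc (Suc n))"] ij(2) occurrence_alternates unfolding n t by auto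
  ultimately have "t = Suc (Suc n)" using ij(1) unfolding n t by simp
  then show "\<exists>n. occurrence u w (pos n) \<and> i = pos n \<and> j = pos (Suc (Suc n))"
    using n t ij(2) by blast
next
  assume "\<exists>n. occurrence u w (pos n) \<and> i = pos n \<and> j = pos (Suc (Suc n))"
  then obtain n where n: "occurrence u w (pos n)" "i = pos n" "j = pos (Suc (Suc n))" by blast
  have "\<not> occurrence u w x" if x: "pos n < x" "x < pos (Suc (Suc n))" for x
  proof
    assume occ: "occurrence u w x"
    then obtain t where t: "x = pos t"
      using occurrence_or_rev_iff_pos unfolding occurrence_or_rev_def by meson
    then have "t = Suc n" using x by simp
    then show False using occ n(1) occurrence_alternates[of n] t by simp
  qed
  then show "successive_occurrences u w i j"
    using n occurrence_alternates by (simp add: successive_occurrences_def)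
qed

lemma return_words_eq_image:
  "return_words u w = (\<lambda>n. u [pos n \<rightarrow> pos (Suc (Suc n))]) ` {n. occurrence u w (pos n)}"
  unfolding return_words_def successive_iff_pos by blast

text \<open>A return word joins the two bricks of its edge, each without its last
  \<open>length w\<close> letters. Conversely, the return word followed by \<open>w\<close> contains
  both bricks, and the first one fixes where the second starts.\<close>

lemma return_word_eq_iff_edge_eq:
  assumes m: "occurrence u w (pos m)" and n: "occurrence u w (pos n)"
  shows "u [pos m \<rightarrow> pos (Suc (Suc m))] = u [pos n \<rightarrow> pos (Suc (Suc n))] \<longleftrightarrow> edge m = edge n"
proof
  have factors: "u [pos i \<rightarrow> pos (Suc (Suc i))] =
      take (length (brick i) - length w) (brick i) @
      take (length (brick (Suc i)) - length w) (brick (Suc i))" for i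
  proof -
    have le: "pos i \<le> pos (Suc i)" "pos (Suc i) \<le> pos (Suc (Suc i))" by simp_all
    have "take (length (brick i) - length w) (brick i) = u [pos i \<rightarrow> pos (Suc i)]"
      and "take (length (brick (Suc i)) - length w) (brick (Suc i)) = u [pos (Suc i) \<rightarrow> pos (Suc (Suc i))]"
      unfolding length_brick unfolding brick_def using le by (simp_all add: min_absorb1)
    then show ?thesis using subsequence_concat[OF le, of u] by simp
  qed
  assume "edge m = edge n"
  then have "brick m = brick n" "brick (Suc m) = brick (Suc n)" using m n by (auto simp: edge_def)
  then show "u [pos m \<rightarrow> pos (Suc (Suc m))] = u [pos n \<rightarrow> pos (Suc (Suc n))]"
    unfolding factors by simp
next
  assume eq: "u [pos m \<rightarrow> pos (Suc (Suc m))] = u [pos n \<rightarrow> pos (Suc (Suc n))]"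
  let ?l = "length w"
  have append: "u [pos i \<rightarrow> pos (Suc (Suc i)) + ?l] = u [pos i \<rightarrow> pos (Suc (Suc i))] @ w"
    if "occurrence u w (pos i)" for i
  proof -
    have "occurrence u w (pos (Suc (Suc i)))" using that occurrence_alternates by simp
    then show ?thesis
      using subsequence_concat[of "pos i" "pos (Suc (Suc i))" "pos (Suc (Suc i)) + ?l" u]
      by (simp add: occurrence_def)
  qed
  have occ: "occurrence u (u [pos m \<rightarrow> pos (Suc (Suc m)) + ?l]) (pos n)"
    unfolding append[OF m] eq unfolding append[OF n, symmetric] by (rule occurrence_subsequence)
  have le: "pos m \<le> pos (Suc m)" "pos (Suc m) \<le> pos (Suc (Suc m))" by simp_all
  have "occurrence u (brick m) (pos n)"
    using occurrence_subsequence_shift[OF occ, of 0 "brick m"] occurrence_brick_self[of m] le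
    by (simp add: length_brick)
  note n_eq = occurrence_brick[OF this]
  have "occurrence u (brick (Suc m)) (pos n + (pos (Suc m) - pos m))"
    using occurrence_subsequence_shift[OF occ, of "pos (Suc m) - pos m" "brick (Suc m)"]
      occurrence_brick_self[of "Suc m"] le
    by (simp add: length_brick)
  then have "brick (Suc n) = brick (Suc m)"
    unfolding n_eq(2)[symmetric] by (rule occurrence_brick(1))
  then show "edge m = edge n" using n_eq(1) m n by (simp add: edge_def)
qed

lemma card_return_words:
  assumes fin: "finite (bricks u w)"
  shows "card (bricks u w) = Suc (card (return_words u w))"
proof -
  have fin_bricks: "finite (range brick)" using fin by (simp add: bricks_eq_range)
  have "range edge \<subseteq> range brick \<times> range brick" by (auto simp: edge_def)
  then have fin_edges: "finite (range edge)" using fin_bricks by (meson finite_SigmaI finite_subset)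
  obtain M where M: "\<And>n. M \<le> n \<Longrightarrow> brick ` {..<n} = range brick"
    using finite_range_initial_segment[OF fin_bricks] by blast
  obtain N where N: "\<And>n. N \<le> n \<Longrightarrow> edge ` {..<n} = range edge"
    using finite_range_initial_segment[OF fin_edges] by blast
  have "card (range brick) = Suc (card (range edge))"
    using card_visited_bricks[of "max M N"] M[of "Suc (max M N)"] N[of "max M N"]
    by (simp add: lessThan_Suc_atMost)
  also have "card (range edge) = card (return_words u w)"
    unfolding edges_eq_image return_words_eq_image
    by (rule card_image_eq_if_same_kernel) (use return_word_eq_iff_edge_eq in simp)
  finally show ?thesis by (simp add: bricks_eq_range)
qed

end

theorem corollary25:
  fixes A :: "'a set" and u :: "'a word" and k :: nat
  assumes "infinite_word_over A u"
    and "card A = k"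
    and "uniformly_recurrent u"
    and "\<forall>w\<in>language u. palindrome w \<longrightarrow> (\<exists>!v. v \<in> palindromic_extensions u w)"
  shows "rich u \<longleftrightarrow> (\<forall>w\<in>language u. card (return_words u w) = k)"
proof -
  interpret unique_palindromic_extensions A u
    using assms(1,3,4) by unfold_locales
  have "A \<noteq> {}" using assms(1) by (auto simp: infinite_word_over_def)
  \<comment> \<open>Positivity lets a cardinality equation imply finiteness, since infinite sets
    have \<open>card\<close> equal to \<open>0\<close>.\<close>
  then have k: "k > 0" using assms(2) finite_alphabet by (auto simp: card_gt_0_iff)
  show ?thesis
  proof
    assume rich: "rich u"
    show "\<forall>w\<in>language u. card (return_words u w) = k"
    proof
      fix w assume w: "w \<in> language u"
      have "palindrome v" if "v \<in> bricks u w" for v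
        using that rich_consecutive_palindrome[OF rich] by (auto simp: bricks_def)
      then have "{v \<in> bricks u w. palindrome v} = bricks u w" by blast
      then have card: "card (bricks u w) = (if palindrome w then k else Suc k)"
        using card_palindromic_bricks[OF w] assms(2) by simp
      show "card (return_words u w) = k"
      proof (cases "palindrome w")
        case True
        then show ?thesis using card card_bricks_palindrome by metis
      next
        case False
        interpret rich_nonpalindrome u w
          using assms(3) rich w False by unfold_locales (simp_all add: uniformly_recurrent_def)
        have "finite (bricks u w)" using card False by (intro card_ge_0_finite) simp
        then show ?thesis using card_return_words card False by simp
      qed
    qed
  next
    assume returns: "\<forall>w\<in>language u. card (return_words u w) = k"
    show "rich u"
    proof (rule rich_if_complete_returns_palindromic)
      fix p i j
      assume p: "p \<in> language u" "palindrome p" and succ: "successive_occurrences u p i j"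
      have card: "card (bricks u p) = k" using card_bricks_palindrome[OF p(2)] returns p(1) by metis
      have "finite (bricks u p)" using card k by (intro card_ge_0_finite) simp
      \<comment> \<open>The palindrome \<open>p\<close> has \<open>k\<close> palindromic bricks and
        only \<open>k\<close> bricks in all, so every brick is a palindrome.\<close>
      moreover have "card {v \<in> bricks u p. palindrome v} = card (bricks u p)"
        using card_palindromic_bricks[OF p(1)] p(2) card assms(2) by simp
      ultimately have "{v \<in> bricks u p. palindrome v} = bricks u p"
        by (intro card_subset_eq) auto
      moreover have "u [i \<rightarrow> j + length p] \<in> bricks u p"
        using succ consecutive_palindrome[OF p(2)] unfolding bricks_def by blast
      ultimately show "palindrome (u [i \<rightarrow> j + length p])" by blast
    qed
  qed
qed

end
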